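(* Let $r,\ell$ be positive integers. For every coloring $c:\mathbf{N}\to\{0,\dots,r-1\}$ there exist an infinite apart set $X$ of positive integers and positive integers $a,b$ such that all elements of $FS^{\{a,\,a+b,\,a+2b,\dots,a+(\ell-1)b\}}(X)$ have the same color under $c$.
   Context: $\mathbf{N}$ is the set of natural numbers. For a positive integer $n=2^{t_1}+\dots+2^{t_k}$ with $t_1<\dots<t_k$ let $\lambda(n)=t_1$ and $\mu(n)=t_k$. A set $X$ of positive integers is apart (satisfies the Apartness Condition) if for all $x,x'\in X$ with $x<x'$ we have $\mu(x)<\lambda(x')$. For a set $A$ of positive integers and a set $B\subseteq\mathbf{N}$, $FS^{A}(B)$ denotes the set of all sums of exactly $j$ distinct elements of $B$, for all $j\in A$. *)

theory Defs
  imports Complex_Main "HOL-Library.Nat_Bijection"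
begin

(* set_decode n is the set of exponents {t_1 < ... < t_k} in the binary expansion of n;
   see binary_expansion and binary_expansion_unique below. Min and Max are meaningful
   here only for n > 0, where the set is nonempty. *)

definition lam :: "nat \<Rightarrow> nat" where
  "lam n = Min (set_decode n)"

definition mu :: "nat \<Rightarrow> nat" where
  "mu n = Max (set_decode n)"

lemma binary_expansion: "finite (set_decode n)" "n = (\<Sum>t\<in>set_decode n. 2 ^ t)"
  using set_decode_inverse[of n] by (simp_all add: set_encode_def)

lemma binary_expansion_unique:
  assumes "finite T" and "n = (\<Sum>t\<in>T. 2 ^ t)"
  shows "set_decode n = T"
  using set_encode_inverse[OF assms(1)] assms(2) by (simp add: set_encode_def)

definition apart :: "nat set \<Rightarrow> bool" where
  "apart X \<longleftrightarrow> (\<forall>x\<in>X. \<forall>x'\<in>X. x < x' \<longrightarrow> mu x < lam x')"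

definition FS :: "nat set \<Rightarrow> nat set \<Rightarrow> nat set" where
  "FS A B = {(\<Sum>x\<in>S. x) | S. S \<subseteq> B \<and> finite S \<and> card S \<in> A}"

end

(* By Ramsey's theorem for exponents 0, ..., W there is an infinite set of powers of two such
   that the colour of a sum of exactly j of its members depends only on j, for each j \<le> W.
   This induces a colouring of the possible numbers j of summands; if W is a van der Waerden
   number, that colouring has a monochromatic arithmetic progression of length l.

   Van der Waerden's theorem is proved by colour focusing. *)
theory Submission
  imports Defs "HOL-Library.Ramsey"
begin

section \<open>Van der Waerden's theorem\<close>

(* The progression is a + b, ..., a + l b; only its terms are coloured alike, but the
   point a in front of them must exist too, as it serves as the next focus. *)
definition vdw_bound :: "nat \<Rightarrow> nat \<Rightarrow> nat \<Rightarrow> bool" where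
  "vdw_bound l r W \<longleftrightarrow>
     (\<forall>c :: nat \<Rightarrow> nat. (\<forall>x. c x < r) \<longrightarrow>
        (\<exists>a b. b > 0 \<and> a + l * b < W \<and> (\<forall>i\<in>{1..l}. c (a + i * b) = c (a + b))))"

text \<open>The index starts at 0 here: this is the progression of \<open>l + 1\<close> terms that
  arises when a focus joins the \<open>l\<close> terms behind it.\<close>

definition mono_ap :: "(nat \<Rightarrow> nat) \<Rightarrow> nat \<Rightarrow> nat \<Rightarrow> bool" where
  "mono_ap c l W \<longleftrightarrow> (\<exists>a b. b > 0 \<and> a + l * b < W \<and> (\<forall>i\<le>l. c (a + i * b) = c a))"

(* For each k in K, f is followed by a progression of length l and colour k with
   difference d k; the point f extends one of these progressions as soon as its own colour is in K. *)
definition focused :: "(nat \<Rightarrow> nat) \<Rightarrow> nat \<Rightarrow> nat \<Rightarrow> nat set \<Rightarrow> nat \<Rightarrow> (nat \<Rightarrow> nat) \<Rightarrow> bool" where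
  "focused c l W K f d \<longleftrightarrow> f < W \<and>
     (\<forall>k\<in>K. d k > 0 \<and> f + l * d k < W \<and> (\<forall>i\<in>{1..l}. c (f + i * d k) = k))"

lemma mono_ap_shift:
  assumes "mono_ap (\<lambda>x. c (m + x)) l W" and "m + W \<le> V"
  shows "mono_ap c l V"
proof -
  obtain a b where "b > 0" "a + l * b < W" "\<forall>i\<le>l. c (m + (a + i * b)) = c (m + a)"
    using assms(1) unfolding mono_ap_def by blast
  then have "b > 0 \<and> (m + a) + l * b < V \<and> (\<forall>i\<le>l. c ((m + a) + i * b) = c (m + a))"
    using assms(2) by (auto simp: add.assoc)
  then show ?thesis unfolding mono_ap_def by blast
qed

lemma focused_imp_mono_ap:
  assumes "focused c l W K f d" and "c f \<in> K"
  shows "mono_ap c l W"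
proof -
  have d: "d (c f) > 0" "f + l * d (c f) < W" "\<forall>i\<in>{1..l}. c (f + i * d (c f)) = c f"
    using assms unfolding focused_def by auto
  have "c (f + i * d (c f)) = c f" if "i \<le> l" for i
    using d(3) that by (cases "i = 0") auto
  with d show ?thesis unfolding mono_ap_def by blast
qed

text \<open>Give each \<open>y\<close> as its new colour the list of the colours of
  \<open>y\<close>, ..., \<open>y + W - 1\<close>. There are only finitely many such lists, and the
  assumption covers every number of colours.\<close>

lemma vdw_bound_blocks:
  assumes "\<And>r. \<exists>W. vdw_bound l r W"
  shows "\<exists>N. \<forall>c :: nat \<Rightarrow> nat. (\<forall>x. c x < r) \<longrightarrow>
    (\<exists>a b. b > 0 \<and> a + l * b < N \<and> (\<forall>i\<in>{1..l}. \<forall>x<W. c (a + i * b + x) = c (a + b + x)))"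
proof -
  define L where "L = {xs. set xs \<subseteq> {..<r} \<and> length xs = W}"
  have "finite L" unfolding L_def by (rule finite_lists_length_eq) simp
  then obtain h where h: "bij_betw h L {0..<card L}"
    using ex_bij_betw_finite_nat by blast
  obtain N where N: "vdw_bound l (card L) N"
    using assms by blast
  have "\<exists>a b. b > 0 \<and> a + l * b < N \<and> (\<forall>i\<in>{1..l}. \<forall>x<W. c (a + i * b + x) = c (a + b + x))"
    if c: "\<forall>x. c x < r" for c :: "nat \<Rightarrow> nat"
  proof -
    define B where "B y = map (\<lambda>x. c (y + x)) [0..<W]" for y
    have B: "B y \<in> L" for y
      using c by (auto simp: B_def L_def)
    have hB: "h (B y) < card L" for y
      using bij_betwE[OF h] B by auto
    then obtain a b where ab: "b > 0" "a + l * b < N"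
      and eq: "\<forall>i\<in>{1..l}. h (B (a + i * b)) = h (B (a + b))"
      using N[unfolded vdw_bound_def, rule_format, of "\<lambda>y. h (B y)", OF hB] by auto
    have "c (a + i * b + x) = c (a + b + x)" if "i \<in> {1..l}" "x < W" for i x
    proof -
      have "B (a + i * b) = B (a + b)"
        using eq that(1) B h by (metis bij_betw_imp_inj_on inj_onD)
      then have "B (a + i * b) ! x = B (a + b) ! x" by simp
      then show ?thesis using that(2) by (simp add: B_def)
    qed
    with ab show ?thesis by blast
  qed
  then show ?thesis by blast
qed

text \<open>Induction on \<open>s\<close>: inside one of \<open>l\<close> equally spaced,
  identically coloured blocks there are \<open>s\<close> progressions with a common focus. If the
  colour of the focus is among theirs, a longer progression results; otherwise it is a new colour,
  and moving the focus to the place in front of the blocks gains a progression in that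
  colour.\<close>

lemma focusing:
  assumes vdw: "\<And>r. \<exists>W. vdw_bound l r W" and "l \<ge> 1"
  shows "\<exists>W. \<forall>c. (\<forall>x. c x < r) \<longrightarrow> mono_ap c l W \<or>
    (\<exists>K f d. K \<subseteq> {..<r} \<and> card K = s \<and> focused c l W K f d)"
proof (induction s)
  case 0
  have "focused c l 1 {} 0 d" for c d by (simp add: focused_def)
  then have "\<exists>K f d. K \<subseteq> {..<r} \<and> card K = 0 \<and> focused c l 1 K f d" for c
    by (intro exI[of _ "{}"] exI[of _ 0]) simp
  then show ?case by blast
next
  case (Suc s)
  then obtain W where W: "\<And>c. \<forall>x. c x < r \<Longrightarrow> mono_ap c l W \<or>
    (\<exists>K f d. K \<subseteq> {..<r} \<and> card K = s \<and> focused c l W K f d)" by blast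
  obtain N where N: "\<And>c. \<forall>x. c x < r \<Longrightarrow>
    (\<exists>a b. b > 0 \<and> a + l * b < N \<and> (\<forall>i\<in>{1..l}. \<forall>x<W. c (a + i * b + x) = c (a + b + x)))"
    using vdw_bound_blocks[OF vdw, of r W] by blast
  have "mono_ap c l (N + W) \<or>
      (\<exists>K f d. K \<subseteq> {..<r} \<and> card K = Suc s \<and> focused c l (N + W) K f d)"
    if c: "\<forall>x. c x < r" for c
  proof -
    obtain p b where b: "b > 0" "p + l * b < N"
      and block: "\<And>i x. i \<in> {1..l} \<Longrightarrow> x < W \<Longrightarrow> c (p + i * b + x) = c (p + b + x)"
      using N[OF c] by blast
    \<comment> \<open>The blocks at \<open>p + i * b\<close> for \<open>i\<close> in
      \<open>{1..l}\<close> agree, so the first of them stands for all.\<close>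
    define c' where "c' x = c (p + b + x)" for x
    have "b \<le> l * b" using \<open>l \<ge> 1\<close> by simp
    then have le: "p + b + W \<le> N + W" using b by linarith
    have shift: ?thesis if "mono_ap c' l W"
      using mono_ap_shift[OF that[unfolded c'_def] le] by blast
    from W[of c'] c consider "mono_ap c' l W"
      | K f d where "K \<subseteq> {..<r}" "card K = s" "focused c' l W K f d"
      unfolding c'_def by blast
    then show ?thesis
    proof cases
      case 1
      then show ?thesis by (rule shift)
    next
      case (2 K f d)
      show ?thesis
      proof (cases "c' f \<in> K")
        case True
        then show ?thesis using focused_imp_mono_ap[OF 2(3)] shift by blast
      next
        case False
        define K' where "K' = insert (c' f) K"
        \<comment> \<open>The new focus \<open>p + f\<close> is position \<open>f\<close> of the
          block with index 0, whose colours are unknown. In an old colour the progression moves by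
          one block and by \<open>d k\<close> inside it at each step; in the new colour it runs
          through the copies of \<open>f\<close>.\<close>
        define d' where "d' k = (if k \<in> K then b + d k else b)" for k
        have K': "K' \<subseteq> {..<r}" "card K' = Suc s"
          using False 2 c finite_subset[OF 2(1)] by (auto simp: K'_def c'_def)
        have f: "f < W" using 2(3) by (simp add: focused_def)
        have "focused c l (N + W) K' (p + f) d'"
          unfolding focused_def
        proof (intro conjI ballI)
          show "p + f < N + W" using b f by simp
        next
          fix k assume "k \<in> K'"
          show "d' k > 0" using b by (simp add: d'_def)
          show "p + f + l * d' k < N + W"
          proof (cases "k \<in> K")
            case True
            then have "f + l * d k < W" using 2(3) by (simp add: focused_def)
            then show ?thesis using b True by (simp add: d'_def algebra_simps)
          qed (use b f in \<open>simp add: d'_def\<close>)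
        next
          fix k i assume k: "k \<in> K'" and i: "i \<in> {1..l}"
          show "c (p + f + i * d' k) = k"
          proof (cases "k \<in> K")
            case True
            then have dk: "f + l * d k < W" "c' (f + i * d k) = k"
              using 2(3) i by (auto simp: focused_def)
            have "i * d k \<le> l * d k" using i by simp
            then have "f + i * d k < W" using dk(1) by linarith
            \<comment> \<open>The position lies inside the block, so its colour can be read off in
              the first block.\<close>
            then have "c (p + i * b + (f + i * d k)) = k"
              using block[OF i] dk(2) by (simp add: c'_def)
            then show ?thesis using True by (simp add: d'_def algebra_simps)
          next
            case False
            then have "k = c' f" using k by (simp add: K'_def)
            then show ?thesis
              using block[OF i f] False by (simp add: d'_def c'_def algebra_simps)
          qed
        qed
        with K' show ?thesis by blast
      qed
    qed
  qed
  then show ?case by blast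
qed

text \<open>With as many focused progressions as there are colours, the colour of the focus must be
  one of theirs.\<close>

lemma vdw_bound_Suc:
  assumes vdw: "\<And>r. \<exists>W. vdw_bound l r W" and "l \<ge> 1"
  shows "\<exists>W. vdw_bound (Suc l) r W"
proof -
  obtain W where W: "\<And>c. \<forall>x. c x < r \<Longrightarrow> mono_ap c l W \<or>
    (\<exists>K f d. K \<subseteq> {..<r} \<and> card K = r \<and> focused c l W K f d)"
    using focusing[OF assms, of r r] by blast
  have ap: "mono_ap c l W" if c: "\<forall>x. c x < r" for c
    using W[OF c]
  proof
    assume "\<exists>K f d. K \<subseteq> {..<r} \<and> card K = r \<and> focused c l W K f d"
    then obtain K f d where K: "K \<subseteq> {..<r}" "card K = r" "focused c l W K f d" by blast
    then have "K = {..<r}" by (simp add: card_subset_eq)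
    then show ?thesis using K c focused_imp_mono_ap by blast
  qed
  have "\<exists>a b. b > 0 \<and> a + Suc l * b < W + W \<and> (\<forall>i\<in>{1..Suc l}. c (a + i * b) = c (a + b))"
    if c: "\<forall>x. c x < r" for c
  proof -
    \<comment> \<open>Shifting by \<open>W\<close> makes room for the point in front of the
      progression, which lies \<open>b \<le> W\<close> before its first term.\<close>
    have "mono_ap (\<lambda>x. c (W + x)) l W" using ap c by simp
    then obtain a b where ab: "b > 0" "a + l * b < W" "\<forall>i\<le>l. c (W + (a + i * b)) = c (W + a)"
      unfolding mono_ap_def by blast
    have "b \<le> l * b" using \<open>l \<ge> 1\<close> by simp
    then have bW: "b \<le> W" using ab(2) by linarith
    have "c (W + a - b + i * b) = c (W + a - b + b)" if "i \<in> {1..Suc l}" for i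
    proof -
      define j where "j = i - 1"
      have "i = Suc j" "j \<le> l" using that by (auto simp: j_def)
      then show ?thesis using ab(3) bW by (simp add: add.assoc)
    qed
    moreover have "W + a - b + Suc l * b < W + W" using ab(2) bW by simp
    ultimately show ?thesis using ab(1) by blast
  qed
  then show ?thesis unfolding vdw_bound_def by blast
qed

theorem van_der_Waerden:
  assumes "l \<ge> 1"
  shows "\<exists>W. vdw_bound l r W"
  using assms
proof (induction l arbitrary: r rule: nat_induct_at_least)
  case base
  have "vdw_bound 1 r 2"
    unfolding vdw_bound_def by (intro allI impI exI[of _ 0] exI[of _ 1]) simp
  then show ?case by blast
next
  case (Suc l)
  then show ?case using vdw_bound_Suc by blast
qed

section \<open>Sums of powers of two\<close>

text \<open>Ramsey's theorem is applied once for each size below \<open>n\<close>, each time inside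
  the previous infinite set; what holds for smaller sizes survives the passage to a subset.\<close>

lemma Ramsey_simultaneous:
  fixes g :: "'a set \<Rightarrow> nat"
  assumes "infinite Z" and g: "\<And>S. g S < r"
  shows "\<exists>Y d. Y \<subseteq> Z \<and> infinite Y \<and> (\<forall>j. d j < r) \<and>
    (\<forall>S. S \<subseteq> Y \<longrightarrow> finite S \<longrightarrow> card S < n \<longrightarrow> g S = d (card S))"
proof (induction n)
  case 0
  \<comment> \<open>No set has size below 0, so any colour below \<open>r\<close> will do as the
    value of \<open>d\<close>; \<open>g {}\<close> is one.\<close>
  then show ?case using assms by (intro exI[of _ Z] exI[of _ "\<lambda>_. g {}"]) simp
next
  case (Suc n)
  then obtain Y d where Y: "Y \<subseteq> Z" "infinite Y" "\<forall>j. d j < r"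
    "\<And>S. S \<subseteq> Y \<Longrightarrow> finite S \<Longrightarrow> card S < n \<Longrightarrow> g S = d (card S)" by blast
  obtain Y' t where Y': "Y' \<subseteq> Y" "infinite Y'" "t < r"
    "\<And>S. S \<subseteq> Y' \<Longrightarrow> finite S \<Longrightarrow> card S = n \<Longrightarrow> g S = t"
    using Ramsey[OF Y(2), of n g r] g by blast
  have "g S = (d(n := t)) (card S)" if "S \<subseteq> Y'" "finite S" "card S < Suc n" for S
    using that Y(4)[of S] Y'(1) Y'(4)[of S] by (cases "card S = n") auto
  moreover have "\<forall>j. (d(n := t)) j < r" using Y(3) Y'(3) by simp
  ultimately show ?case using Y(1) Y'(1,2) by blast
qed

text \<open>A power of two has a single exponent, so \<open>lam\<close> and \<open>mu\<close>
  coincide on it and grow with it.\<close>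

lemma apart_powers_of_two:
  assumes "X \<subseteq> range (\<lambda>t. 2 ^ t)"
  shows "apart X"
proof -
  have "set_decode (2 ^ t) = {t}" for t
    by (rule binary_expansion_unique) simp_all
  then have "lam (2 ^ t) = t" "mu (2 ^ t) = t" for t
    by (simp_all add: lam_def mu_def)
  moreover have "t < u" if "(2::nat) ^ t < 2 ^ u" for t u
    using that by simp
  ultimately show ?thesis using assms unfolding apart_def by (metis imageE subsetD)
qed

theorem mainTheorem7:
  fixes r l :: nat and c :: "nat \<Rightarrow> nat"
  assumes "r > 0" and "l > 0"
    and "\<forall>n. c n \<in> {0..<r}"
  shows "\<exists>X a b. infinite X \<and> X \<subseteq> {0<..} \<and> apart X \<and> a > 0 \<and> b > 0 \<and>
           (\<exists>k. \<forall>s \<in> FS {a + i * b | i. i < l} X. c s = k)"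
proof -
  obtain W where W: "vdw_bound l r W"
    using van_der_Waerden[of l r] assms(2) by auto
  define P :: "nat set" where "P = range (\<lambda>t. 2 ^ t)"
  have "infinite P"
    unfolding P_def by (rule range_inj_infinite) (simp add: inj_def)
  then obtain X d where X: "X \<subseteq> P" "infinite X" and d: "\<forall>j. d j < r"
    and cd: "\<And>S. S \<subseteq> X \<Longrightarrow> finite S \<Longrightarrow> card S < W \<Longrightarrow> c (\<Sum>S) = d (card S)"
    using Ramsey_simultaneous[of P "\<lambda>S. c (\<Sum>S)" r W] assms(3) by auto
  obtain a b where b: "b > 0" "a + l * b < W" "\<forall>i\<in>{1..l}. d (a + i * b) = d (a + b)"
    using W d unfolding vdw_bound_def by blast
  \<comment> \<open>Since \<open>a\<close> may be 0, the progression of sizes starts at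
    \<open>a + b\<close>; its term with index \<open>i\<close> is
    \<open>a + Suc i * b\<close>.\<close>
  have "c s = d (a + b)" if "s \<in> FS {a + b + i * b | i. i < l} X" for s
  proof -
    obtain S i where S: "s = \<Sum>S" "S \<subseteq> X" "finite S" "card S = a + Suc i * b" "i < l"
      using \<open>s \<in> _\<close> by (auto simp: FS_def add.assoc)
    have "Suc i * b \<le> l * b" using S(5) by (intro mult_right_mono) auto
    then have "c s = d (a + Suc i * b)" using cd[OF S(2,3)] S(1,4) b(2) by simp
    also have "\<dots> = d (a + b)" using b(3)[rule_format, of "Suc i"] S(5) by simp
    finally show ?thesis .
  qed
  moreover have "X \<subseteq> {0<..}" "apart X"
    using X(1) apart_powers_of_two by (auto simp: P_def)
  ultimately show ?thesis
    using X(2) b(1) by (intro exI[of _ X] exI[of _ "a + b"] exI[of _ b]) auto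
qed

end
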